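(* Let $\mathcal{P}$ be a family of finite posets, and set $h=h(\mathcal{P})\ge 2$ and $w=w(\mathcal{P})$. The class of $\mathcal{P}$-free posets and the class of $C_h$-free posets are indistinguishable. Namely, every $C_h$-free poset is $\mathcal{P}$-free, and if a poset $P$ is $\mathcal{P}$-free then it has a $C_h$-free subposet obtained by the removal of at most $2\left(\frac{h^2w^2}{|P|}\right)^{\frac{1}{hw^2}}|P|^2$ edges.
   Context: All posets are finite. A poset is a set with an anti-reflexive, transitive relation $\prec$; it is regarded as a digraph whose edges are the pairs $(x,y)$ with $x\prec y$. $|P|$ is the number of elements of $P$. The height $h(P)$ is the number of elements of a longest chain of $P$, and the width $w(P)$ is the size of a largest antichain of $P$. For a (possibly infinite) family $\mathcal{P}$ of finite posets, $h(\mathcal{P})=\min_{P\in\mathcal{P}}h(P)$ and $w(\mathcal{P})=\min\{w(P): P\in\mathcal{P},\ h(P)=h(\mathcal{P})\}$. $C_h$ is the chain with $h$ elements. Subposets are not necessarily induced: a subposet of $P$ obtained by the removal of edges is a poset on the same set of elements whose edge set is obtained from that of $P$ by deleting those edges. $P$ is $Q$-free if it does not contain $Q$ as a (not necessarily induced) subposet, i.e. there is no injective map $f:Q\to P$ with $f(x)\prec f(y)$ whenever $x\prec y$; $P$ is $\mathcal{P}$-free if it is $Q$-free for every $Q\in\mathcal{P}$. Two properties (isomorphism-closed classes) $\Phi_1,\Phi_2$ of posets are indistinguishable if for every $\varepsilon>0$ and $i=1,2$ there exists $N$ such that for every poset $P$ on at least $N$ elements with property $\Phi_i$ there exists a poset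 $P'$ on the same set with property $\Phi_{3-i}$ obtained by changing at most $\varepsilon|P|^2$ edges of $P$. *)

theory Defs
  imports Complex_Main
begin

text \<open>A poset is a pair of a ground set and a strict order on it, the latter given as
  the set of pairs (edges) \<open>(x, y)\<close> with \<open>x\<close> below \<open>y\<close>.\<close>

type_synonym 'a poset = "'a set \<times> 'a rel"

abbreviation verts :: "'a poset \<Rightarrow> 'a set" where
  "verts P \<equiv> fst P"

abbreviation edges :: "'a poset \<Rightarrow> 'a rel" where
  "edges P \<equiv> snd P"

definition finite_poset :: "'a poset \<Rightarrow> bool" where
  "finite_poset P \<longleftrightarrow>
     finite (verts P) \<and> edges P \<subseteq> verts P \<times> verts P \<and> irrefl (edges P) \<and> trans (edges P)"

definition is_chain :: "'a poset \<Rightarrow> 'a set \<Rightarrow> bool" where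
  "is_chain P C \<longleftrightarrow> C \<subseteq> verts P \<and> total_on C (edges P)"

definition is_antichain :: "'a poset \<Rightarrow> 'a set \<Rightarrow> bool" where
  "is_antichain P A \<longleftrightarrow> A \<subseteq> verts P \<and> pairwise (\<lambda>x y. (x, y) \<notin> edges P) A"

definition height :: "'a poset \<Rightarrow> nat" where
  "height P = Max (card ` {C. is_chain P C})"

definition width :: "'a poset \<Rightarrow> nat" where
  "width P = Max (card ` {A. is_antichain P A})"

text \<open>On nonempty sets of natural numbers the infimum is the minimum; the family may be
  infinite, so \<open>Min\<close> cannot be used.\<close>

definition family_height :: "'a poset set \<Rightarrow> nat" where
  "family_height F = (INF P\<in>F. height P)"

definition family_width :: "'a poset set \<Rightarrow> nat" where
  "family_width F = (INF P\<in>{P \<in> F. height P = family_height F}. width P)"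

definition chain_poset :: "nat \<Rightarrow> nat poset" where
  "chain_poset h = ({..<h}, {(i, j). i < j \<and> j < h})"

text \<open>Containment as a not necessarily induced subposet.\<close>

definition contains_poset :: "'a poset \<Rightarrow> 'b poset \<Rightarrow> bool" where
  "contains_poset P Q \<longleftrightarrow>
     (\<exists>f. inj_on f (verts Q) \<and> f ` verts Q \<subseteq> verts P \<and>
          (\<forall>x y. (x, y) \<in> edges Q \<longrightarrow> (f x, f y) \<in> edges P))"

definition poset_free :: "'b poset \<Rightarrow> 'a poset \<Rightarrow> bool" where
  "poset_free Q P \<longleftrightarrow> \<not> contains_poset P Q"

definition family_free :: "'b poset set \<Rightarrow> 'a poset \<Rightarrow> bool" where
  "family_free F P \<longleftrightarrow> (\<forall>Q\<in>F. poset_free Q P)"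

definition edge_subposet :: "'a poset \<Rightarrow> 'a poset \<Rightarrow> bool" where
  "edge_subposet P' P \<longleftrightarrow>
     finite_poset P' \<and> verts P' = verts P \<and> edges P' \<subseteq> edges P"

definition poset_iso :: "'a poset \<Rightarrow> 'a poset \<Rightarrow> bool" where
  "poset_iso P Q \<longleftrightarrow>
     (\<exists>f. bij_betw f (verts P) (verts Q) \<and>
          (\<forall>x\<in>verts P. \<forall>y\<in>verts P. (x, y) \<in> edges P \<longleftrightarrow> (f x, f y) \<in> edges Q))"

definition poset_property :: "'a poset set \<Rightarrow> bool" where
  "poset_property \<Phi> \<longleftrightarrow>
     (\<forall>P\<in>\<Phi>. finite_poset P) \<and>
     (\<forall>P Q. P \<in> \<Phi> \<longrightarrow> finite_poset Q \<longrightarrow> poset_iso P Q \<longrightarrow> Q \<in> \<Phi>)"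

text \<open>The number of changed edges is the size of the symmetric difference of the edge sets.\<close>

definition approximable_by :: "'a poset set \<Rightarrow> 'a poset set \<Rightarrow> bool" where
  "approximable_by \<Phi> \<Psi> \<longleftrightarrow>
     (\<forall>\<epsilon>::real. \<epsilon> > 0 \<longrightarrow>
       (\<exists>N::nat. \<forall>P\<in>\<Phi>. card (verts P) \<ge> N \<longrightarrow>
         (\<exists>P'\<in>\<Psi>. verts P' = verts P \<and>
            real (card ((edges P - edges P') \<union> (edges P' - edges P)))
              \<le> \<epsilon> * real (card (verts P)) ^ 2)))"

definition indistinguishable :: "'a poset set \<Rightarrow> 'a poset set \<Rightarrow> bool" where
  "indistinguishable \<Phi> \<Psi> \<longleftrightarrow>
     poset_property \<Phi> \<and> poset_property \<Psi> \<and> approximable_by \<Phi> \<Psi> \<and> approximable_by \<Psi> \<Phi>"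

end

theory Submission
  imports Defs
begin

text \<open>Every poset of height at least \<open>h\<close> contains a chain of \<open>h\<close> elements, so
  freeness from that chain implies freeness from the whole family
  (\<open>chain_free_imp_family_free\<close>). The substance is the converse up to few edges, and
  it only uses one member \<open>Q\<close> of the family, of height \<open>h\<close> and width \<open>w\<close>.

  Splitting \<open>Q\<close> into its \<open>h\<close> levels, which are antichains, shows that \<open>Q\<close> lies in
  every poset that contains \<open>h\<close> sets of \<open>w\<close> elements each, every set lying entirely
  below the next (\<open>contains_of_complete_levels\<close>). Given a \<open>Q\<close>-free poset \<open>P\<close> on \<open>n\<close>
  elements and a threshold \<open>\<epsilon>\<close>, let \<open>X\<^sub>0\<close> be the set of all elements and let
  \<open>X\<^sub>i\<^sub>+\<^sub>1\<close> consist of the elements of \<open>X\<^sub>i\<close> with at least \<open>\<epsilon> n\<close> predecessors in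
  \<open>X\<^sub>i\<close>. There are two cases.

  If the last set \<open>X\<^sub>h\<^sub>-\<^sub>1\<close> has at most \<open>\<epsilon> n\<close> elements, rank every element by
  the last \<open>X\<^sub>i\<close> containing it. At most \<open>2 \<epsilon> n\<^sup>2\<close> edges fail to increase the
  rank or end in \<open>X\<^sub>h\<^sub>-\<^sub>1\<close>, and deleting them leaves too few ranks for a chain of
  \<open>h\<close> elements (\<open>chain_free_subposet_of_few_rich\<close>).

  If it has more, the sets of \<open>w\<close> elements are found from the top down. Whenever \<open>B\<close> is a
  large subset of \<open>X\<^sub>i\<^sub>+\<^sub>1\<close>, double counting in the manner of Kovari, Sos and Turan
  yields \<open>w\<close> elements of \<open>B\<close> with about \<open>\<epsilon>\<^sup>w n\<close> common predecessors in
  \<open>X\<^sub>i\<close>, and these common predecessors serve as the next \<open>B\<close>. By transitivity each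
  level only has to be related to the one directly above it
  (\<open>complete_levels_below_rich_set\<close>). So \<open>P\<close> would contain \<open>Q\<close>. The stated bound is
  the choice \<open>\<epsilon> = (h\<^sup>2 w\<^sup>2 / n) powr (1 / (h w\<^sup>2))\<close>; since it tends to 0
  with growing \<open>n\<close>, it also gives indistinguishability.\<close>

section \<open>Containment, chains and levels\<close>

lemma contains_poset_trans:
  assumes "contains_poset P Q" "contains_poset Q R"
  shows "contains_poset P R"
proof -
  obtain f where f: "inj_on f (verts Q)" "f ` verts Q \<subseteq> verts P"
      "\<And>x y. (x, y) \<in> edges Q \<Longrightarrow> (f x, f y) \<in> edges P"
    using assms(1) unfolding contains_poset_def by blast
  obtain g where g: "inj_on g (verts R)" "g ` verts R \<subseteq> verts Q"
      "\<And>x y. (x, y) \<in> edges R \<Longrightarrow> (g x, g y) \<in> edges Q"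
    using assms(2) unfolding contains_poset_def by blast
  have "inj_on (f \<circ> g) (verts R)"
    using f(1) g(1,2) by (meson comp_inj_on inj_on_subset)
  moreover have "(f \<circ> g) ` verts R \<subseteq> verts P" using f(2) g(2) by auto
  ultimately show ?thesis
    unfolding contains_poset_def using f(3) g(3) by (intro exI[of _ "f \<circ> g"]) auto
qed

lemma poset_iso_contains:
  assumes "poset_iso P Q" "finite_poset Q"
  shows "contains_poset P Q"
proof -
  obtain f where f: "bij_betw f (verts P) (verts Q)"
      "\<And>x y. x \<in> verts P \<Longrightarrow> y \<in> verts P \<Longrightarrow> (x, y) \<in> edges P \<longleftrightarrow> (f x, f y) \<in> edges Q"
    using assms(1) unfolding poset_iso_def by blast
  define g where "g = inv_into (verts P) f"
  have g: "bij_betw g (verts Q) (verts P)"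
    unfolding g_def using f(1) by (rule bij_betw_inv_into)
  have fg: "f (g y) = y" if "y \<in> verts Q" for y
    unfolding g_def using f(1) that by (rule bij_betw_inv_into_right)
  have gV: "g y \<in> verts P" if "y \<in> verts Q" for y
    using g that by (auto simp: bij_betw_def)
  have "(g x, g y) \<in> edges P" if "(x, y) \<in> edges Q" for x y
  proof -
    have "x \<in> verts Q" "y \<in> verts Q" using that assms(2) unfolding finite_poset_def by auto
    then show ?thesis using f(2)[of "g x" "g y"] fg gV that by simp
  qed
  then show ?thesis using g unfolding contains_poset_def bij_betw_def by (intro exI[of _ g]) auto
qed

lemma finite_total_order_enumeration:
  assumes "finite C" "irrefl E" "trans E" "total_on C E"
  shows "\<exists>f. inj_on f {..<card C} \<and> f ` {..<card C} \<subseteq> C \<and>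
             (\<forall>i j. i < j \<and> j < card C \<longrightarrow> (f i, f j) \<in> E)"
  using assms(1,4)
proof (induction "card C" arbitrary: C)
  case 0
  then show ?case by auto
next
  case (Suc k)
  \<comment> \<open>The last position is filled by a maximal element, which by totality lies above all others.\<close>
  have "acyclic (E\<inverse> \<inter> C \<times> C)"
  proof -
    have "acyclic E" using assms(2,3) by (simp add: acyclic_irrefl)
    then have "acyclic (E\<inverse>)" by simp
    then show ?thesis by (rule acyclic_subset) auto
  qed
  moreover have "finite (E\<inverse> \<inter> C \<times> C)" using Suc.prems by auto
  ultimately have "wf (E\<inverse> \<inter> C \<times> C)" by (rule finite_acyclic_wf[rotated])
  moreover have "C \<noteq> {}" using Suc.hyps by auto
  ultimately obtain m where m: "m \<in> C" "\<And>y. (y, m) \<in> E\<inverse> \<inter> C \<times> C \<Longrightarrow> y \<notin> C"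
    by (meson ex_in_conv wfE_min)
  have top: "(y, m) \<in> E" if "y \<in> C" "y \<noteq> m" for y
    using Suc.prems(2) that m unfolding total_on_def by blast
  have card': "k = card (C - {m})" using m(1) Suc.hyps(2) Suc.prems(1) by simp
  have "total_on (C - {m}) E" using Suc.prems(2) unfolding total_on_def by blast
  then obtain f where f: "inj_on f {..<k}" "f ` {..<k} \<subseteq> C - {m}"
      "\<And>i j. i < j \<Longrightarrow> j < k \<Longrightarrow> (f i, f j) \<in> E"
    using Suc.hyps(1)[OF card'] Suc.prems(1) card' by auto
  have cC: "{..<card C} = insert k {..<k}" using Suc.hyps(2) by auto
  have fk: "f i \<in> C" "f i \<noteq> m" if "i < k" for i using f(2) that by auto
  have "inj_on (f(k := m)) {..<card C}"
    unfolding cC using f(1) fk by (auto simp: inj_on_def)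
  moreover have "(f(k := m)) ` {..<card C} \<subseteq> C"
    unfolding cC using fk m(1) by auto
  moreover have "((f(k := m)) i, (f(k := m)) j) \<in> E" if "i < j" "j < card C" for i j
    using that f(3) fk top Suc.hyps(2) by (cases "j = k") auto
  ultimately show ?case by blast
qed

lemma finite_chains:
  assumes "finite_poset Q"
  shows "finite {C. is_chain Q C}"
  by (rule finite_subset[of _ "Pow (verts Q)"])
     (use assms in \<open>auto simp: is_chain_def finite_poset_def\<close>)

lemma is_chain_empty: "is_chain Q {}"
  by (simp add: is_chain_def)

lemma card_chain_le_height:
  assumes "finite_poset Q" "is_chain Q C"
  shows "card C \<le> height Q"
  unfolding height_def using finite_chains[OF assms(1)] assms(2) by (intro Max_ge) auto

lemma card_antichain_le_width:
  assumes "finite_poset Q" "is_antichain Q A"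
  shows "card A \<le> width Q"
proof -
  have "finite {A. is_antichain Q A}"
    by (rule finite_subset[of _ "Pow (verts Q)"])
       (use assms in \<open>auto simp: is_antichain_def finite_poset_def\<close>)
  then show ?thesis unfolding width_def using assms(2) by (intro Max_ge) auto
qed

lemma contains_chain_poset_height:
  assumes "finite_poset Q" "k \<le> height Q"
  shows "contains_poset Q (chain_poset k)"
proof -
  have "height Q \<in> card ` {C. is_chain Q C}"
    unfolding height_def using finite_chains[OF assms(1)] is_chain_empty[of Q]
    by (intro Max_in) auto
  then obtain C where C: "is_chain Q C" "card C = height Q" by auto
  then have "finite C"
    using assms(1) unfolding is_chain_def finite_poset_def by (auto intro: finite_subset)
  then obtain f where f: "inj_on f {..<card C}" "f ` {..<card C} \<subseteq> C"
      "\<forall>i j. i < j \<and> j < card C \<longrightarrow> (f i, f j) \<in> edges Q"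
    using finite_total_order_enumeration[of C "edges Q"] C(1) assms(1)
    unfolding is_chain_def finite_poset_def by auto
  have "inj_on f {..<k}" using f(1) assms(2) C(2) by (auto intro: inj_on_subset)
  moreover have "f ` {..<k} \<subseteq> verts Q"
    using f(2) assms(2) C unfolding is_chain_def by fastforce
  ultimately show ?thesis
    unfolding contains_poset_def chain_poset_def using f(3) assms(2) C(2) by auto
qed

text \<open>The level of an element is the size of a largest chain strictly below it; adding the
  element to such a chain shows that levels increase along edges.\<close>

lemma level_decomposition:
  assumes Q: "finite_poset Q"
  obtains l where "\<And>x. x \<in> verts Q \<Longrightarrow> l x < height Q"
    and "\<And>x y. (x, y) \<in> edges Q \<Longrightarrow> l x < l y"
    and "\<And>i. card {x \<in> verts Q. l x = i} \<le> width Q"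
proof -
  define below where "below x = {C. is_chain Q C \<and> (\<forall>c\<in>C. (c, x) \<in> edges Q)}" for x
  define l where "l x = Max (card ` below x)" for x
  have fin: "finite (below x)" for x
    using finite_chains[OF Q] by (rule finite_subset[rotated]) (auto simp: below_def)
  have ne: "{} \<in> below x" for x by (simp add: below_def is_chain_empty)
  have ext: "is_chain Q (insert x C)" "card (insert x C) = Suc (card C)"
    if "x \<in> verts Q" "C \<in> below x" for x C
  proof -
    show "is_chain Q (insert x C)"
      using that unfolding below_def is_chain_def total_on_def by auto
    have "x \<notin> C" using that(2) Q unfolding below_def finite_poset_def irrefl_def by blast
    moreover have "finite C"
      using that(2) Q unfolding below_def is_chain_def finite_poset_def
      by (auto intro: finite_subset)
    ultimately show "card (insert x C) = Suc (card C)" by simp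
  qed
  have attained: "\<exists>C\<in>below x. card C = l x" for x
  proof -
    have "l x \<in> card ` below x"
      unfolding l_def using fin[of x] ne[of x] by (intro Max_in) auto
    then show ?thesis by auto
  qed
  have "l x < height Q" if "x \<in> verts Q" for x
    using attained[of x] ext[OF that] card_chain_le_height[OF Q] by (metis Suc_le_eq)
  moreover have mono: "l x < l y" if "(x, y) \<in> edges Q" for x y
  proof -
    obtain C where C: "C \<in> below x" "card C = l x" using attained by blast
    have x: "x \<in> verts Q" using that Q unfolding finite_poset_def by auto
    have "insert x C \<in> below y"
      using ext(1)[OF x C(1)] C(1) that Q
      unfolding below_def finite_poset_def by (auto dest: transD)
    then have "card (insert x C) \<le> l y"
      unfolding l_def using fin[of y] by (intro Max_ge) auto
    then show ?thesis using ext(2)[OF x C(1)] C(2) by simp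
  qed
  moreover have "card {x \<in> verts Q. l x = i} \<le> width Q" for i
  proof (rule card_antichain_le_width[OF Q])
    show "is_antichain Q {x \<in> verts Q. l x = i}"
      unfolding is_antichain_def pairwise_def using mono by fastforce
  qed
  ultimately show ?thesis using that by blast
qed

text \<open>Each level of \<open>Q\<close> can be placed arbitrarily inside the corresponding set \<open>S i\<close>;
  distinct levels cannot collide, because a common element of \<open>S i\<close> and \<open>S j\<close> would lie
  below itself.\<close>

lemma contains_of_complete_levels:
  assumes P: "finite_poset P" and Q: "finite_poset Q"
    and S: "\<And>i. i < height Q \<Longrightarrow> S i \<subseteq> verts P \<and> card (S i) = width Q"
    and SS: "\<And>i j. i < j \<Longrightarrow> j < height Q \<Longrightarrow> S i \<times> S j \<subseteq> edges P"
  shows "contains_poset P Q"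
proof -
  obtain l where l: "\<And>x. x \<in> verts Q \<Longrightarrow> l x < height Q"
      "\<And>x y. (x, y) \<in> edges Q \<Longrightarrow> l x < l y"
      "\<And>i. card {x \<in> verts Q. l x = i} \<le> width Q"
    using level_decomposition[OF Q] by blast
  have "\<exists>g. g ` {x \<in> verts Q. l x = i} \<subseteq> S i \<and> inj_on g {x \<in> verts Q. l x = i}"
    if "i < height Q" for i
  proof (rule card_le_inj)
    show "finite {x \<in> verts Q. l x = i}" using Q by (simp add: finite_poset_def)
    show "finite (S i)" using S[OF that] P unfolding finite_poset_def by (auto intro: finite_subset)
    show "card {x \<in> verts Q. l x = i} \<le> card (S i)" using l(3) S[OF that] by simp
  qed
  then have "\<exists>g. \<forall>i\<in>{..<height Q}.
      g i ` {x \<in> verts Q. l x = i} \<subseteq> S i \<and> inj_on (g i) {x \<in> verts Q. l x = i}"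
    by (intro bchoice) simp
  then obtain g where "\<forall>i\<in>{..<height Q}.
      g i ` {x \<in> verts Q. l x = i} \<subseteq> S i \<and> inj_on (g i) {x \<in> verts Q. l x = i}" ..
  then have g: "\<And>i. i < height Q \<Longrightarrow> g i ` {x \<in> verts Q. l x = i} \<subseteq> S i"
      "\<And>i. i < height Q \<Longrightarrow> inj_on (g i) {x \<in> verts Q. l x = i}"
    by simp_all
  define f where "f x = g (l x) x" for x
  have fS: "f x \<in> S (l x)" if "x \<in> verts Q" for x
    using g(1)[OF l(1)[OF that]] that unfolding f_def by auto
  have lt: "(f x, f y) \<in> edges P" if "x \<in> verts Q" "y \<in> verts Q" "l x < l y" for x y
    using SS[OF that(3) l(1)[OF that(2)]] fS that by blast
  have "inj_on f (verts Q)"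
  proof (rule inj_onI)
    fix x y assume xy: "x \<in> verts Q" "y \<in> verts Q" "f x = f y"
    have "(f x, f x) \<notin> edges P" using P unfolding finite_poset_def irrefl_def by blast
    then have "\<not> l x < l y" "\<not> l y < l x" using lt[of x y] lt[of y x] xy by auto
    then have "l x = l y" by simp
    then show "x = y" using g(2)[OF l(1)[OF xy(1)]] xy unfolding f_def inj_on_def by auto
  qed
  moreover have "f ` verts Q \<subseteq> verts P" using fS S l(1) by blast
  moreover have "(f x, f y) \<in> edges P" if "(x, y) \<in> edges Q" for x y
    using lt[of x y] l(2)[OF that] that Q unfolding finite_poset_def by blast
  ultimately show ?thesis unfolding contains_poset_def by blast
qed

section \<open>Small sets with many common predecessors\<close>

lemma power_tangent_line:
  fixes a x :: real
  assumes "0 \<le> a" "0 \<le> x" "1 \<le> k"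
  shows "a ^ k + real k * a ^ (k - 1) * (x - a) \<le> x ^ k"
proof (cases "a = 0")
  case True
  obtain j where "k = Suc j" using assms(3) by (cases k) auto
  then show ?thesis using True assms(2) by (cases j) auto
next
  case False
  then have a: "a > 0" using assms by simp
  obtain j where j: "k = Suc j" using assms(3) by (cases k) auto
  have "1 + real k * (x / a - 1) \<le> (1 + (x / a - 1)) ^ k"
    by (rule Bernoulli_inequality) (use a assms in simp)
  then have "a ^ k * (1 + real k * (x / a - 1)) \<le> a ^ k * (x / a) ^ k"
    using a by (intro mult_left_mono) auto
  also have "a ^ k * (x / a) ^ k = x ^ k" using a by (simp add: power_divide)
  also have "a ^ k * (1 + real k * (x / a - 1)) = a ^ k + real k * a ^ j * (a * (x / a - 1))"
    unfolding j power_Suc by (simp only: distrib_left mult_ac mult_1_right)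
  also have "a * (x / a - 1) = x - a" using a by (simp add: right_diff_distrib)
  finally show ?thesis using j by simp
qed

text \<open>Summing the tangent lines at \<open>a\<close> gives the power mean inequality in a form where
  \<open>n\<close> may exceed the number of summands: the missing ones count as zeros.\<close>

lemma power_mean_sum:
  fixes x :: "'a \<Rightarrow> real"
  assumes "finite X" "real (card X) \<le> n" "0 \<le> a" "1 \<le> k"
    and "\<And>y. y \<in> X \<Longrightarrow> 0 \<le> x y" and "n * a \<le> (\<Sum>y\<in>X. x y)"
  shows "n * a ^ k \<le> (\<Sum>y\<in>X. x y ^ k)"
proof -
  define c where "c = real (card X)"
  have ak: "a ^ k = a * a ^ (k - 1)" using assms(4) by (cases k) auto
  have "n * a ^ k \<le> c * a ^ k + real k * a ^ (k - 1) * (n * a - c * a)"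
  proof -
    have "1 * ((n - c) * a ^ k) \<le> real k * ((n - c) * a ^ k)"
      using assms(2-4) unfolding c_def by (intro mult_right_mono) auto
    then show ?thesis unfolding ak by (simp add: algebra_simps)
  qed
  also have "\<dots> \<le> c * a ^ k + real k * a ^ (k - 1) * ((\<Sum>y\<in>X. x y) - c * a)"
    using assms(3,6) by (intro add_left_mono mult_left_mono) auto
  also have "\<dots> = (\<Sum>y\<in>X. a ^ k + real k * a ^ (k - 1) * (x y - a))"
    unfolding c_def by (simp add: sum.distrib sum_subtractf flip: sum_distrib_left)
  also have "\<dots> \<le> (\<Sum>y\<in>X. x y ^ k)"
    using assms by (intro sum_mono power_tangent_line) auto
  finally show ?thesis .
qed

lemma power_le_fact_binomial: "(d + 1 - k) ^ k \<le> fact k * (d choose k)"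
proof (cases "k \<le> d")
  case True
  then show ?thesis
  proof (induction k arbitrary: d)
    case 0
    then show ?case by simp
  next
    case (Suc k)
    then obtain e where e: "d = Suc e" by (cases d) auto
    have "(d + 1 - Suc k) ^ Suc k = (e + 1 - k) * (e + 1 - k) ^ k" using e by simp
    also have "\<dots> \<le> Suc e * (fact k * (e choose k))"
      using Suc.IH[of e] Suc.prems e by (intro mult_mono) auto
    also have "\<dots> = fact k * (Suc e * (e choose k))" by (rule mult.left_commute)
    also have "\<dots> = fact (Suc k) * (d choose Suc k)"
      unfolding e Suc_times_binomial_eq fact_Suc of_nat_id by (simp only: mult_ac)
    finally show ?case .
  qed
next
  case False
  then show ?thesis by (cases k) auto
qed

text \<open>Both sides of the double count run over the pairs of a \<open>k\<close>-subset of \<open>B\<close> and a common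
  predecessor of it: grouped by predecessor they are counted by binomial coefficients of the
  degrees into \<open>B\<close>, which are bounded below by convexity.\<close>

lemma subset_with_many_common_predecessors:
  fixes X :: "'a set" and B :: "'b set" and E :: "('a \<times> 'b) set" and a n :: real
  assumes X: "finite X" "real (card X) \<le> n" and B: "finite B" "k \<le> card B"
    and k: "1 \<le> k" "real k \<le> a * real (card B)"
    and deg: "\<And>b. b \<in> B \<Longrightarrow> a * n \<le> real (card {y \<in> X. (y, b) \<in> E})"
  shows "\<exists>S\<subseteq>B. card S = k \<and>
           n * (a - real k / real (card B)) ^ k \<le> real (card {y \<in> X. \<forall>b\<in>S. (y, b) \<in> E})"
proof (rule ccontr)
  define b where "b = real (card B)"
  \<comment> \<open>Binomial coefficients of degrees are bounded below by powers of degrees lowered by at most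
    \<open>k\<close>, so the average degree \<open>a * b\<close> enters lowered by \<open>k\<close>.\<close>
  define A where "A = a * b - real k"
  define d where "d y = card {z \<in> B. (y, z) \<in> E}" for y
  define com where "com S = card {y \<in> X. \<forall>z\<in>S. (y, z) \<in> E}" for S
  define K where "K = {S. S \<subseteq> B \<and> card S = k}"
  assume "\<not> ?thesis"
  then have contra: "\<not> n * (a - real k / b) ^ k \<le> real (com S)" if "S \<in> K" for S
    using that unfolding K_def com_def b_def by blast
  have b: "b > 0" using B k unfolding b_def by simp
  have "a - real k / b = A / b" using b unfolding A_def by (simp add: field_simps)
  then have less: "real (com S) < n * (A / b) ^ k" if "S \<in> K" for S
    using contra[OF that] by simp
  have n: "n \<ge> 0" using X by simp
  have A: "A \<ge> 0" using k unfolding A_def b_def by simp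
  have finK: "finite K" unfolding K_def using B by simp
  have cK: "card K = card B choose k" unfolding K_def using B(1) by (rule n_subsets)
  have cK0: "0 < card K" unfolding cK using B(2) by simp

  have count: "(\<Sum>S\<in>K. com S) = (\<Sum>y\<in>X. d y choose k)"
    unfolding com_def
  proof (rule sum_multicount_gen[OF finK X(1)], intro ballI)
    fix y
    have "{S \<in> K. \<forall>z\<in>S. (y, z) \<in> E} = {S. S \<subseteq> {z \<in> B. (y, z) \<in> E} \<and> card S = k}"
      unfolding K_def by auto
    also have "card \<dots> = d y choose k"
      unfolding d_def using B(1) by (intro n_subsets) auto
    finally show "card {S \<in> K. \<forall>z\<in>S. (y, z) \<in> E} = d y choose k" .
  qed

  have "(\<Sum>y\<in>X. d y) = (\<Sum>z\<in>B. card {y \<in> X. (y, z) \<in> E})"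
    unfolding d_def by (rule sum_multicount_gen[OF X(1) B(1)]) simp
  then have "(\<Sum>z\<in>B. real (card {y \<in> X. (y, z) \<in> E})) = (\<Sum>y\<in>X. real (d y))"
    unfolding of_nat_sum[symmetric] by (simp only:)
  moreover have "(\<Sum>z\<in>B. a * n) \<le> (\<Sum>z\<in>B. real (card {y \<in> X. (y, z) \<in> E}))"
    using deg by (intro sum_mono)
  ultimately have dsum: "b * (a * n) \<le> (\<Sum>y\<in>X. real (d y))" unfolding b_def by simp

  have "n * A \<le> (\<Sum>y\<in>X. real (d y)) - real (card X) * real k"
  proof -
    have "real (card X) * real k \<le> n * real k" using X by (intro mult_right_mono) auto
    then show ?thesis using dsum unfolding A_def by (simp add: algebra_simps)
  qed
  also have "\<dots> = (\<Sum>y\<in>X. real (d y) - real k)" by (simp add: sum_subtractf)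
  also have "\<dots> \<le> (\<Sum>y\<in>X. real (d y + 1 - k))" by (intro sum_mono) auto
  finally have "n * A ^ k \<le> (\<Sum>y\<in>X. real (d y + 1 - k) ^ k)"
    using X A k by (intro power_mean_sum) auto
  also have "\<dots> \<le> (\<Sum>y\<in>X. real (fact k * (d y choose k)))"
    unfolding of_nat_power[symmetric]
    by (intro sum_mono of_nat_mono power_le_fact_binomial)
  also have "\<dots> = fact k * real (\<Sum>S\<in>K. com S)"
    unfolding count by (simp add: sum_distrib_left)
  also have "\<dots> < fact k * (real (card K) * (n * (A / b) ^ k))"
  proof (intro mult_strict_left_mono)
    have "(\<Sum>S\<in>K. real (com S)) < (\<Sum>S\<in>K. n * (A / b) ^ k)"
      using less finK cK0 by (intro sum_strict_mono) auto
    then show "real (\<Sum>S\<in>K. com S) < real (card K) * (n * (A / b) ^ k)" by simp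
  qed simp
  also have "\<dots> = real ((card B choose k) * fact k) * (n * (A / b) ^ k)"
    unfolding cK by simp
  finally have "n * A ^ k < real ((card B choose k) * fact k) * (n * (A / b) ^ k)" .
  moreover have "real ((card B choose k) * fact k) * (n * (A / b) ^ k) \<le> b ^ k * (n * (A / b) ^ k)"
  proof (rule mult_right_mono)
    show "real ((card B choose k) * fact k) \<le> b ^ k"
      unfolding b_def of_nat_power[symmetric] by (intro of_nat_mono binomial_fact_pow)
    show "0 \<le> n * (A / b) ^ k" using n A b by simp
  qed
  moreover have "b ^ k * (n * (A / b) ^ k) = n * (b * (A / b)) ^ k"
    unfolding power_mult_distrib by (simp only: mult_ac)
  moreover have "b * (A / b) = A" using b by simp
  ultimately show False by simp
qed

text \<open>A size of \<open>B\<close> of at least \<open>2 k\<^sup>2 / a\<close> loses at most half of the guaranteed number of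
  common predecessors.\<close>

lemma subset_with_common_predecessors_half:
  fixes X :: "'a set" and B :: "'b set" and E :: "('a \<times> 'b) set" and a n :: real
  assumes X: "finite X" "real (card X) \<le> n" and B: "finite B" "2 * real k ^ 2 \<le> a * real (card B)"
    and k: "1 \<le> k" and a: "0 < a" "a \<le> 1"
    and deg: "\<And>b. b \<in> B \<Longrightarrow> a * n \<le> real (card {y \<in> X. (y, b) \<in> E})"
  shows "\<exists>S\<subseteq>B. card S = k \<and> n * a ^ k / 2 \<le> real (card {y \<in> X. \<forall>b\<in>S. (y, b) \<in> E})"
proof -
  define b where "b = real (card B)"
  have kk: "real k \<le> real k ^ 2" using k by (simp add: power2_eq_square)
  have ab: "real k \<le> a * b" unfolding b_def using B(2) kk by linarith
  then have b: "b > 0" using k a by (smt (verit) mult_nonneg_nonpos of_nat_1 of_nat_mono)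
  have "a * b \<le> b" using a b by simp
  then have kb: "k \<le> card B" using ab unfolding b_def by linarith
  have "1 / 2 \<le> 1 + real k * (- (real k / (a * b)))"
    using B(2) a b unfolding b_def by (simp add: field_simps power2_eq_square)
  also have "\<dots> \<le> (1 + (- (real k / (a * b)))) ^ k"
    by (rule Bernoulli_inequality) (use ab a b in \<open>simp add: field_simps\<close>)
  finally have "a ^ k * (1 / 2) \<le> a ^ k * (1 - real k / (a * b)) ^ k"
    using a by (intro mult_left_mono) auto
  also have "\<dots> = (a - real k / b) ^ k"
  proof -
    have "a * (1 - real k / (a * b)) = a - real k / b" using a b by (simp add: field_simps)
    then show ?thesis unfolding power_mult_distrib[symmetric] by (simp only:)
  qed
  finally have "n * (a ^ k * (1 / 2)) \<le> n * (a - real k / b) ^ k"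
    using X by (intro mult_left_mono) auto
  then have half: "n * a ^ k / 2 \<le> n * (a - real k / b) ^ k" by simp
  obtain S where "S \<subseteq> B" "card S = k"
      "n * (a - real k / b) ^ k \<le> real (card {y \<in> X. \<forall>b\<in>S. (y, b) \<in> E})"
    using subset_with_many_common_predecessors[OF X B(1) kb k ab[unfolded b_def] deg]
    unfolding b_def by blast
  then show ?thesis using half by (intro exI[of _ S]) auto
qed

section \<open>Iterated rich sets\<close>

text \<open>\<open>rich P c i\<close> consists of the elements that are robustly at the top of a chain of
  \<open>i + 1\<close> elements: each of them has at least \<open>c\<close> predecessors that are rich one step lower.\<close>

fun rich :: "'a poset \<Rightarrow> real \<Rightarrow> nat \<Rightarrow> 'a set" where
  "rich P c 0 = verts P"
| "rich P c (Suc i) = {x \<in> rich P c i. c \<le> real (card {y \<in> rich P c i. (y, x) \<in> edges P})}"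

lemma rich_antimono: "i \<le> j \<Longrightarrow> rich P c j \<subseteq> rich P c i"
  by (rule lift_Suc_antimono_le[of "rich P c"]) auto

lemma rich_subset_verts: "rich P c i \<subseteq> verts P"
  using rich_antimono[of 0 i P c] by simp

text \<open>The level below \<open>S\<close> is chosen among the common predecessors of \<open>S\<close>. Relations between
  non-consecutive levels come from transitivity, so the lower bound on the number of common
  predecessors is the same at every step instead of deteriorating with the number of levels.\<close>

lemma complete_levels_below_rich_set:
  assumes P: "finite_poset P" and n: "n = real (card (verts P))"
    and k: "1 \<le> k" and a: "0 < a" "a \<le> 1"
    and m: "m = n * a ^ k / 2" "2 * real k ^ 2 \<le> a * m"
    and B: "B \<subseteq> rich P (a * n) i" "m \<le> real (card B)"
  shows "\<exists>S. S i \<subseteq> B \<and> (\<forall>j\<le>i. S j \<subseteq> verts P \<and> card (S j) = k) \<and>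
             (\<forall>j j'. j < j' \<and> j' \<le> i \<longrightarrow> S j \<times> S j' \<subseteq> edges P)"
  using B
proof (induction i arbitrary: B)
  case 0
  have "0 \<le> m" unfolding m(1) n using a by simp
  then have "a * m \<le> m" using a by (simp add: mult_left_le_one_le)
  moreover have "real k \<le> real k ^ 2" using k by (simp add: power2_eq_square)
  ultimately have "k \<le> card B" using m(2) 0(2) by linarith
  then obtain T where "T \<subseteq> B" "card T = k" by (meson obtain_subset_with_card_n)
  then show ?case using 0(1) by (intro exI[of _ "\<lambda>_. T"]) auto
next
  case (Suc i)
  define X where "X = rich P (a * n) i"
  have finV: "finite (verts P)" using P by (simp add: finite_poset_def)
  have XV: "X \<subseteq> verts P" unfolding X_def by (rule rich_subset_verts)
  have BV: "B \<subseteq> verts P" using Suc.prems(1) rich_subset_verts by (rule subset_trans)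
  have X: "finite X" "real (card X) \<le> n"
    using finite_subset[OF XV finV] card_mono[OF finV XV] unfolding n by simp_all
  have finB: "finite B" using BV finV by (rule finite_subset)
  have "a * m \<le> a * real (card B)" using Suc.prems(2) a by simp
  then have sz: "2 * real k ^ 2 \<le> a * real (card B)" using m(2) by linarith
  have deg: "a * n \<le> real (card {y \<in> X. (y, b) \<in> edges P})" if "b \<in> B" for b
    using subsetD[OF Suc.prems(1) that] unfolding X_def by simp
  have "\<exists>T\<subseteq>B. card T = k \<and> m \<le> real (card {y \<in> X. \<forall>b\<in>T. (y, b) \<in> edges P})"
    unfolding m(1) by (rule subset_with_common_predecessors_half[OF X finB sz k a deg])
  then obtain T where T: "T \<subseteq> B" "card T = k"
      "m \<le> real (card {y \<in> X. \<forall>b\<in>T. (y, b) \<in> edges P})"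
    by (elim exE conjE)
  define Y where "Y = {y \<in> X. \<forall>b\<in>T. (y, b) \<in> edges P}"
  have Y: "Y \<subseteq> rich P (a * n) i" "m \<le> real (card Y)"
    using T(3) unfolding Y_def X_def by auto
  obtain S where S: "S i \<subseteq> Y"
      "\<forall>j\<le>i. S j \<subseteq> verts P \<and> card (S j) = k"
      "\<forall>j j'. j < j' \<and> j' \<le> i \<longrightarrow> S j \<times> S j' \<subseteq> edges P"
    using Suc.IH[OF Y] by (elim exE conjE)
  have "S i \<noteq> {}" using S(2) k by force
  then obtain s where s: "s \<in> S i" by blast
  have YT: "Y \<times> T \<subseteq> edges P" unfolding Y_def by auto
  have below_T: "S j \<times> T \<subseteq> edges P" if "j \<le> i" for j
  proof (cases "j = i")
    case True
    then show ?thesis using S(1) YT by blast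
  next
    case False
    then have js: "S j \<times> {s} \<subseteq> edges P" using S(3)[rule_format, of j i] that s by auto
    have sT: "{s} \<times> T \<subseteq> edges P" using S(1) s YT by blast
    have "trans (edges P)" using P by (simp add: finite_poset_def)
    then show ?thesis using js sT by (auto intro: transD[of _ _ s])
  qed
  define S' where "S' = S(Suc i := T)"
  have S'_top: "S' (Suc i) = T" and S'_low: "\<And>j. j \<le> i \<Longrightarrow> S' j = S j"
    unfolding S'_def by auto
  have "S' j \<subseteq> verts P \<and> card (S' j) = k" if "j \<le> Suc i" for j
  proof (cases "j = Suc i")
    case True
    then show ?thesis using S'_top T(1,2) BV by blast
  next
    case False
    then have "j \<le> i" using that by simp
    then show ?thesis using S'_low S(2) by simp
  qed
  moreover have "S' j \<times> S' j' \<subseteq> edges P" if "j < j'" "j' \<le> Suc i" for j j'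
  proof (cases "j' = Suc i")
    case True
    then have "j \<le> i" using that by simp
    then show ?thesis using True S'_top S'_low below_T by simp
  next
    case False
    then have "j' \<le> i" "j \<le> i" using that by auto
    then show ?thesis using S'_low S(3) that(1) by simp
  qed
  ultimately show ?case using S'_top T(1) by (intro exI[of _ S']) simp
qed

text \<open>Ranking every element by the last rich set that contains it, only edges that increase the
  rank and end outside the top rich set are kept. An element \<open>x\<close> of lower rank loses fewer than
  \<open>c\<close> incoming edges, because it fails the next richness test; the few elements of the top
  rich set lose all of theirs. The kept edges are again transitive since ranks are ordered.\<close>

lemma chain_free_subposet_of_few_rich:
  assumes P: "finite_poset P" and n: "n = card (verts P)" and h: "h \<ge> 2"
    and c: "0 \<le> c" and few: "real (card (rich P c (h - 1))) \<le> c"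
  shows "\<exists>P'. edge_subposet P' P \<and> poset_free (chain_poset h) P' \<and>
           real (card (edges P - edges P')) \<le> 2 * c * real n"
proof -
  define V where "V = verts P"
  define E where "E = edges P"
  define T where "T = rich P c (h - 1)"
  define r where "r x = Max {i. i < h \<and> x \<in> rich P c i}" for x
  define E' where "E' = {(y, x) \<in> E. r y < r x \<and> r x < h - 1}"
  have P': "finite V" "E \<subseteq> V \<times> V" "irrefl E" "trans E"
    using P unfolding finite_poset_def V_def E_def by auto
  have T: "T \<subseteq> V" unfolding T_def V_def by (rule rich_subset_verts)
  have r_in: "r x < h \<and> x \<in> rich P c (r x)" if "x \<in> V" for x
  proof -
    have "0 \<in> {i. i < h \<and> x \<in> rich P c i}" using h that unfolding V_def by simp
    then have "r x \<in> {i. i < h \<and> x \<in> rich P c i}" unfolding r_def by (intro Max_in) auto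
    then show ?thesis by simp
  qed
  have r_ge: "i \<le> r x" if "i < h" "x \<in> rich P c i" for x i
    unfolding r_def using that by (intro Max_ge) auto
  define lost where "lost x = {y \<in> rich P c (r x). (y, x) \<in> E}" for x
  have lost_small: "real (card (lost x)) \<le> c" if "x \<in> V" "r x < h - 1" for x
  proof (rule ccontr)
    assume "\<not> ?thesis"
    then have "x \<in> rich P c (Suc (r x))" using r_in[OF that(1)] unfolding lost_def E_def by simp
    then show False using r_ge[of "Suc (r x)" x] that(2) by linarith
  qed
  define low where "low = {x \<in> V. r x < h - 1}"
  have low: "finite low" "low \<subseteq> V" using P' unfolding low_def by auto
  have sub: "E - E' \<subseteq> (\<Union>x\<in>low. lost x \<times> {x}) \<union> V \<times> T"
  proof
    fix e assume e: "e \<in> E - E'"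
    obtain y x where yx: "e = (y, x)" by (cases e)
    have V: "y \<in> V" "x \<in> V" using e yx P'(2) by auto
    show "e \<in> (\<Union>x\<in>low. lost x \<times> {x}) \<union> V \<times> T"
    proof (cases "r x < h - 1")
      case True
      then have "r x \<le> r y" using e yx unfolding E'_def by auto
      then have "y \<in> rich P c (r x)"
        using r_in[OF V(1)] by (intro subsetD[OF rich_antimono[of "r x" "r y" P c]]) simp_all
      then show ?thesis using e yx True V unfolding lost_def low_def by auto
    next
      case False
      then have "r x = h - 1" using r_in[OF V(2)] by linarith
      then have "x \<in> T" using r_in[OF V(2)] unfolding T_def by simp
      then show ?thesis using yx V by auto
    qed
  qed
  have fin_lost: "finite (lost x)" for x
    unfolding lost_def
    using rich_subset_verts[of P c "r x"] P'(1) unfolding V_def by (auto intro: finite_subset)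
  have "real (card (E - E')) \<le> real (card ((\<Union>x\<in>low. lost x \<times> {x}) \<union> V \<times> T))"
    using sub P'(1) T low(1) fin_lost
    by (intro of_nat_mono card_mono) (auto intro: finite_subset)
  also have "\<dots> \<le> real ((\<Sum>x\<in>low. card (lost x \<times> {x})) + card V * card T)"
  proof (intro of_nat_mono)
    have "card ((\<Union>x\<in>low. lost x \<times> {x}) \<union> V \<times> T)
            \<le> card (\<Union>x\<in>low. lost x \<times> {x}) + card (V \<times> T)" by (rule card_Un_le)
    also have "card (\<Union>x\<in>low. lost x \<times> {x}) \<le> (\<Sum>x\<in>low. card (lost x \<times> {x}))"
      by (rule card_UN_le[OF low(1)])
    finally show "card ((\<Union>x\<in>low. lost x \<times> {x}) \<union> V \<times> T)
        \<le> (\<Sum>x\<in>low. card (lost x \<times> {x})) + card V * card T"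
      by (simp add: card_cartesian_product)
  qed
  also have "\<dots> = (\<Sum>x\<in>low. real (card (lost x))) + real n * real (card T)"
    unfolding n V_def by (simp add: card_cartesian_product)
  also have "\<dots> \<le> (\<Sum>x\<in>low. c) + real n * c"
    using lost_small few unfolding low_def T_def
    by (intro add_mono sum_mono mult_left_mono) auto
  also have "\<dots> \<le> real n * c + real n * c"
    using card_mono[OF P'(1) low(2)] c unfolding n V_def
    by (simp add: mult_right_mono mult.commute[of c])
  finally have bound: "real (card (E - E')) \<le> 2 * c * real n" by simp

  have E'E: "E' \<subseteq> E" unfolding E'_def by auto
  have "trans E'" unfolding E'_def
    by (rule transI) (use P'(4) in \<open>auto dest: transD\<close>)
  moreover have "irrefl E'" unfolding E'_def irrefl_def by auto
  ultimately have "edge_subposet (V, E') P"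
    using P' E'E unfolding edge_subposet_def finite_poset_def V_def E_def by auto
  moreover have "poset_free (chain_poset h) (V, E')"
  proof -
    have no_chain: False if f: "\<And>i j. i < j \<Longrightarrow> j < h \<Longrightarrow> (f i, f j) \<in> E'" for f :: "nat \<Rightarrow> 'a"
    proof -
      have "i < h \<longrightarrow> i \<le> r (f i)" for i
      proof (induction i)
        case (Suc i)
        then show ?case using f[of i "Suc i"] unfolding E'_def by auto
      qed simp
      then have "h - 1 \<le> r (f (h - 1))" using h by simp
      moreover have "r (f (h - 1)) < h - 1" using f[of 0 "h - 1"] h unfolding E'_def by auto
      ultimately show False by simp
    qed
    show ?thesis
      unfolding poset_free_def
    proof
      assume "contains_poset (V, E') (chain_poset h)"
      then obtain f where
        "\<forall>x y. (x, y) \<in> edges (chain_poset h) \<longrightarrow> (f x, f y) \<in> edges (V, E')"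
        unfolding contains_poset_def by (elim exE conjE)
      then show False by (intro no_chain[of f]) (simp add: chain_poset_def)
    qed
  qed
  ultimately show ?thesis using bound unfolding E_def by auto
qed

section \<open>The removal bound and indistinguishability\<close>

lemma chain_free_of_edgeless:
  assumes "h \<ge> 2"
  shows "poset_free (chain_poset h) (V, {})"
proof -
  have "(0, 1) \<in> edges (chain_poset h)" using assms by (simp add: chain_poset_def)
  then show ?thesis unfolding poset_free_def contains_poset_def by (metis empty_iff snd_conv)
qed

lemma card_edges_le_square:
  assumes "finite_poset P"
  shows "real (card (edges P)) \<le> real (card (verts P)) ^ 2"
proof -
  have "card (edges P) \<le> card (verts P \<times> verts P)"
    using assms unfolding finite_poset_def by (intro card_mono) auto
  then show ?thesis by (simp add: card_cartesian_product power2_eq_square flip: of_nat_mult)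
qed

lemma powr_inverse_power:
  assumes "0 \<le> t" "k > 0"
  shows "(t powr (1 / real k)) ^ k = t"
  using assms by (cases "t = 0") (auto simp: powr_powr simp flip: powr_realpow)

text \<open>The number \<open>\<epsilon>\<close> in the bound satisfies
  \<open>n * \<epsilon> ^ (h * w^2) = h^2 * w^2\<close>. If it is at least 1, all edges may be removed.
  Otherwise \<open>w + 1 \<le> h * w^2\<close> gives \<open>4 * w^2 \<le> n * \<epsilon> ^ (w + 1)\<close>, which is
  exactly what the construction of complete levels asks of \<open>\<epsilon>\<close>.\<close>

lemma chain_removal:
  assumes P: "finite_poset P" and Q: "finite_poset Q" and PQ: "poset_free Q P"
    and h: "h = height Q" "h \<ge> 2" and w: "w = width Q" "w \<ge> 1"
  shows "\<exists>P'. edge_subposet P' P \<and> poset_free (chain_poset h) P' \<and>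
           real (card (edges P - edges P'))
             \<le> 2 * (real (h^2 * w^2) / real (card (verts P))) powr (1 / real (h * w^2))
                 * real (card (verts P)) ^ 2"
proof -
  define n where "n = card (verts P)"
  define t where "t = real (h^2 * w^2) / real n"
  define \<epsilon> where "\<epsilon> = t powr (1 / real (h * w^2))"
  have n_real: "real n = real (card (verts P))" unfolding n_def ..
  have t0: "0 \<le> t" unfolding t_def by simp
  have hw: "0 < h * w^2" using h w by simp
  have "\<exists>P'. edge_subposet P' P \<and> poset_free (chain_poset h) P' \<and>
           real (card (edges P - edges P')) \<le> 2 * \<epsilon> * real n ^ 2"
    \<comment> \<open>For \<open>n = 0\<close> the quotient \<open>t\<close> is 0 by convention, but there are no edges.\<close>
  proof (cases "n = 0 \<or> 1 \<le> t")
    case True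
    have "edge_subposet (verts P, {}) P"
      using P unfolding edge_subposet_def finite_poset_def by (auto simp: irrefl_def trans_def)
    moreover have "real (card (edges P)) \<le> 2 * \<epsilon> * real n ^ 2"
    proof (cases "n = 0")
      case True
      then show ?thesis using card_edges_le_square[OF P] unfolding n_def by simp
    next
      case False
      then have "1 \<le> \<epsilon>" using True unfolding \<epsilon>_def by (simp add: ge_one_powr_ge_zero)
      then have "1 * real n ^ 2 \<le> (2 * \<epsilon>) * real n ^ 2" by (intro mult_right_mono) auto
      then show ?thesis using card_edges_le_square[OF P] unfolding n_def by linarith
    qed
    ultimately show ?thesis
      using chain_free_of_edgeless[OF h(2), of "verts P"] by (intro exI[of _ "(verts P, {})"]) auto
  next
    case False
    then have n: "n > 0" and t: "t < 1" by auto
    have tn: "t * real n = real h ^ 2 * real w ^ 2" unfolding t_def using n by simp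
    have t_pos: "0 < t" unfolding t_def using n h w by simp
    have \<epsilon>_pos: "0 < \<epsilon>" unfolding \<epsilon>_def using t_pos by simp
    have \<epsilon>_le: "\<epsilon> \<le> 1" unfolding \<epsilon>_def using t t_pos hw by (intro powr_le1) auto
    have \<epsilon>_pow: "\<epsilon> ^ (h * w^2) = t" unfolding \<epsilon>_def by (rule powr_inverse_power[OF t0 hw])
    \<comment> \<open>\<open>m\<close> is the number of common predecessors guaranteed at every level.\<close>
    define m where "m = real n * \<epsilon> ^ w / 2"
    have expo: "w + 1 \<le> h * w^2"
    proof -
      have "w \<le> w^2" using w by (simp add: power2_eq_square)
      moreover have "2 * w^2 \<le> h * w^2" using h by (intro mult_right_mono) auto
      ultimately show ?thesis using w by linarith
    qed
    have "4 * real w ^ 2 \<le> real h ^ 2 * real w ^ 2"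
      using power_mono[of 2 "real h" 2] h by (intro mult_right_mono) auto
    also have "\<dots> = real n * \<epsilon> ^ (h * w^2)" using tn \<epsilon>_pow by (simp add: mult.commute)
    also have "\<dots> \<le> real n * \<epsilon> ^ (w + 1)"
      using expo \<epsilon>_pos \<epsilon>_le by (intro mult_left_mono power_decreasing) auto
    finally have m: "2 * real w ^ 2 \<le> \<epsilon> * m" unfolding m_def by (simp add: mult.commute mult.left_commute)
    have "\<epsilon> ^ w \<le> \<epsilon> ^ 1" using w \<epsilon>_pos \<epsilon>_le by (intro power_decreasing) auto
    then have "real n * \<epsilon> ^ w \<le> \<epsilon> * real n" by (simp add: mult.commute[of \<epsilon>] mult_left_mono)
    moreover have "0 \<le> real n * \<epsilon> ^ w" using \<epsilon>_pos by simp
    ultimately have m_le: "m \<le> \<epsilon> * real n" unfolding m_def by linarith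
    define T where "T = rich P (\<epsilon> * real n) (h - 1)"
    have few: "real (card T) \<le> \<epsilon> * real n"
    proof (rule ccontr)
      assume "\<not> ?thesis"
      then have "m \<le> real (card T)" using m_le by linarith
      then have "\<exists>S. S (h - 1) \<subseteq> T \<and> (\<forall>j\<le>h - 1. S j \<subseteq> verts P \<and> card (S j) = w) \<and>
          (\<forall>j j'. j < j' \<and> j' \<le> h - 1 \<longrightarrow> S j \<times> S j' \<subseteq> edges P)"
        by (intro complete_levels_below_rich_set[OF P n_real w(2) \<epsilon>_pos \<epsilon>_le m_def m])
           (simp_all add: T_def)
      then obtain S where S: "\<forall>j\<le>h - 1. S j \<subseteq> verts P \<and> card (S j) = w"
          "\<forall>j j'. j < j' \<and> j' \<le> h - 1 \<longrightarrow> S j \<times> S j' \<subseteq> edges P"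
        by (elim exE conjE)
      have "contains_poset P Q"
      proof (rule contains_of_complete_levels[OF P Q])
        show "S i \<subseteq> verts P \<and> card (S i) = width Q" if "i < height Q" for i
          using S(1)[rule_format, of i] that h w by simp
        show "S i \<times> S j \<subseteq> edges P" if "i < j" "j < height Q" for i j
          using S(2)[rule_format, of i j] that h by simp
      qed
      then show False using PQ by (simp add: poset_free_def)
    qed
    have "0 \<le> \<epsilon> * real n" using \<epsilon>_pos by simp
    from chain_free_subposet_of_few_rich[OF P n_def h(2) this few[unfolded T_def]]
    show ?thesis by (simp add: power2_eq_square mult.assoc)
  qed
  then show ?thesis unfolding \<epsilon>_def t_def n_def .
qed

lemma family_height_width_attained:
  assumes "F \<noteq> {}"
  obtains Q where "Q \<in> F" "height Q = family_height F" "width Q = family_width F"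
proof -
  have "family_height F \<in> height ` F"
    unfolding family_height_def using assms by (intro Inf_nat_def1) auto
  then obtain Q where "Q \<in> F" "family_height F = height Q" by blast
  then have "Q \<in> {P \<in> F. height P = family_height F}" by simp
  then have "{P \<in> F. height P = family_height F} \<noteq> {}" by blast
  then have "family_width F \<in> width ` {P \<in> F. height P = family_height F}"
    unfolding family_width_def by (intro Inf_nat_def1) (simp only: image_is_empty not_False_eq_True)
  then show ?thesis using that by auto
qed

lemma width_pos:
  assumes "finite_poset Q" "0 < height Q"
  shows "1 \<le> width Q"
proof -
  have "contains_poset Q (chain_poset 1)"
    using assms by (intro contains_chain_poset_height) auto
  then obtain f :: "nat \<Rightarrow> 'a" where "f 0 \<in> verts Q"
    unfolding contains_poset_def chain_poset_def by auto
  then have "is_antichain Q {f 0}" by (simp add: is_antichain_def)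
  from card_antichain_le_width[OF assms(1) this] show ?thesis by simp
qed

lemma chain_free_imp_family_free:
  assumes "\<forall>Q\<in>F. finite_poset Q" "poset_free (chain_poset (family_height F)) P"
  shows "family_free F P"
  unfolding family_free_def poset_free_def
proof (intro ballI notI)
  fix Q assume Q: "Q \<in> F" "contains_poset P Q"
  have "family_height F \<le> height Q"
    unfolding family_height_def using Q(1) by (intro cINF_lower) auto
  then have "contains_poset Q (chain_poset (family_height F))"
    using assms(1) Q(1) by (intro contains_chain_poset_height) auto
  then have "contains_poset P (chain_poset (family_height F))"
    by (rule contains_poset_trans[OF Q(2)])
  then show False using assms(2) by (simp add: poset_free_def)
qed

lemma poset_free_iso:
  assumes "poset_free R P" "finite_poset Q" "poset_iso P Q"
  shows "poset_free R Q"
  using assms contains_poset_trans[OF poset_iso_contains] unfolding poset_free_def by blast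

theorem theorem1p3:
  fixes F :: "'b poset set" and h w :: nat
  assumes "F \<noteq> {}" and "\<forall>Q\<in>F. finite_poset Q"
    and "h = family_height F" and "h \<ge> 2" and "w = family_width F"
  shows "indistinguishable
           {P :: 'a poset. finite_poset P \<and> family_free F P}
           {P :: 'a poset. finite_poset P \<and> poset_free (chain_poset h) P}
    \<and> (\<forall>P :: 'a poset. finite_poset P \<longrightarrow> poset_free (chain_poset h) P \<longrightarrow> family_free F P)
    \<and> (\<forall>P :: 'a poset. finite_poset P \<longrightarrow> family_free F P \<longrightarrow>
         (\<exists>P'. edge_subposet P' P \<and> poset_free (chain_poset h) P' \<and>
            real (card (edges P - edges P'))
              \<le> 2 * (real (h^2 * w^2) / real (card (verts P))) powr (1 / real (h * w^2))
                  * real (card (verts P)) ^ 2))"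
proof -
  obtain Q where Q: "Q \<in> F" "height Q = h" "width Q = w"
    using family_height_width_attained[OF assms(1)] assms(3,5) by metis
  have finQ: "finite_poset Q" using assms(2) Q(1) by blast
  have w: "w \<ge> 1" using width_pos[OF finQ] Q assms(4) by simp
  have easy: "family_free F P" if "poset_free (chain_poset h) P" for P :: "'a poset"
    using chain_free_imp_family_free[OF assms(2)] that assms(3) by simp
  have removal: "\<exists>P'. edge_subposet P' P \<and> poset_free (chain_poset h) P' \<and>
            real (card (edges P - edges P'))
              \<le> 2 * (real (h^2 * w^2) / real (card (verts P))) powr (1 / real (h * w^2))
                  * real (card (verts P)) ^ 2"
    if "finite_poset P" "family_free F P" for P :: "'a poset"
    using chain_removal[OF that(1) finQ _ Q(2)[symmetric] assms(4) Q(3)[symmetric] w] that(2) Q(1)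
    unfolding family_free_def by blast
  let ?\<Phi> = "{P :: 'a poset. finite_poset P \<and> family_free F P}"
  let ?\<Psi> = "{P :: 'a poset. finite_poset P \<and> poset_free (chain_poset h) P}"
  have "poset_property ?\<Phi>" "poset_property ?\<Psi>"
    unfolding poset_property_def family_free_def using poset_free_iso by blast+
  moreover have "approximable_by ?\<Psi> ?\<Phi>"
    unfolding approximable_by_def
  proof (intro allI impI exI[of _ 0] ballI)
    fix \<epsilon> :: real and P assume "\<epsilon> > 0" "P \<in> ?\<Psi>"
    then show "\<exists>P'\<in>?\<Phi>. verts P' = verts P \<and>
        real (card ((edges P - edges P') \<union> (edges P' - edges P))) \<le> \<epsilon> * real (card (verts P)) ^ 2"
      using easy by (intro bexI[of _ P]) auto
  qed
  moreover have "approximable_by ?\<Phi> ?\<Psi>"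
    unfolding approximable_by_def
  proof (intro allI impI)
    fix \<epsilon> :: real assume \<epsilon>: "\<epsilon> > 0"
    define k where "k = h * w^2"
    have k: "k > 0" unfolding k_def using assms(4) w by simp
    define M where "M = real (h^2 * w^2)"
    define N where "N = nat \<lceil>M / (\<epsilon> / 2) ^ k\<rceil> + 1"
    have small: "2 * (M / real n) powr (1 / real k) \<le> \<epsilon>" if "n \<ge> N" for n
    proof -
      have "M / (\<epsilon> / 2) ^ k \<le> real n" using that unfolding N_def by linarith
      moreover have "0 < real n" using that unfolding N_def by simp
      ultimately have "M / real n \<le> (\<epsilon> / 2) ^ k" using \<epsilon> by (simp add: field_simps)
      then have "((M / real n) powr (1 / real k)) ^ k \<le> (\<epsilon> / 2) ^ k"
        using powr_inverse_power[OF _ k, of "M / real n"] unfolding M_def by simp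
      then have "(M / real n) powr (1 / real k) \<le> \<epsilon> / 2"
        using k \<epsilon> by (subst (asm) power_mono_iff) auto
      then show ?thesis by simp
    qed
    show "\<exists>N. \<forall>P\<in>?\<Phi>. N \<le> card (verts P) \<longrightarrow> (\<exists>P'\<in>?\<Psi>. verts P' = verts P \<and>
        real (card ((edges P - edges P') \<union> (edges P' - edges P))) \<le> \<epsilon> * real (card (verts P)) ^ 2)"
    proof (intro exI[of _ N] ballI impI)
      fix P assume P: "P \<in> ?\<Phi>" "N \<le> card (verts P)"
      obtain P' where P': "edge_subposet P' P" "poset_free (chain_poset h) P'"
          "real (card (edges P - edges P'))
             \<le> 2 * (M / real (card (verts P))) powr (1 / real k) * real (card (verts P)) ^ 2"
        using removal[of P] P(1) unfolding M_def k_def by blast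
      have "(edges P - edges P') \<union> (edges P' - edges P) = edges P - edges P'"
        using P'(1) unfolding edge_subposet_def by auto
      moreover have "real (card (edges P - edges P')) \<le> \<epsilon> * real (card (verts P)) ^ 2"
        using P'(3) mult_right_mono[OF small[OF P(2)], of "real (card (verts P)) ^ 2"] by simp
      ultimately show "\<exists>P'\<in>?\<Psi>. verts P' = verts P \<and>
          real (card ((edges P - edges P') \<union> (edges P' - edges P))) \<le> \<epsilon> * real (card (verts P)) ^ 2"
        using P'(1,2) unfolding edge_subposet_def by (intro bexI[of _ P']) auto
    qed
  qed
  ultimately show ?thesis unfolding indistinguishable_def using easy removal by blast
qed

end
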